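(* Let $d \geq 3$ be an integer, let $q$ be a prime power, and let $G$ be a group with $\mathrm{SL}(d,q) \leq G \leq \mathrm{GL}(d,q)$. Let $\kappa(G)$ denote the proportion of reducible pairs in the set of fat pairs in $G \times G$, that is, $$\kappa(G) = \frac{|\{(g_1,g_2) \in G \times G : g_1, g_2 \text{ are fat and } (g_1,g_2) \text{ is reducible}\}|}{|\{(g_1,g_2) \in G \times G : g_1, g_2 \text{ are fat}\}|}.$$ Then $$\kappa(G) < 2q^{-d+1}.$$
   Context: $\mathrm{GL}(d,q)$ is the group of invertible $d \times d$ matrices over the finite field $\mathbb{F}_q$ of order $q$, and $\mathrm{SL}(d,q)$ is its subgroup of matrices of determinant $1$. Let $\mathcal{V} = \mathbb{F}_q^d$ be the space of row vectors of length $d$; every subgroup of $\mathrm{GL}(d,q)$ acts on $\mathcal{V}$ by right multiplication (vector times matrix), making $\mathcal{V}$ a right module (the natural module). An element $g \in \mathrm{GL}(d,q)$ is called fat if $\mathcal{V}$ has an irreducible $\mathbb{F}_q\langle g\rangle$-submodule of dimension $e > d/2$ for some integer $e$. A fat pair is a pair $(g_1,g_2)$ of fat elements. A pair $(g_1,g_2) \in \mathrm{GL}(d,q)\times \mathrm{GL}(d,q)$ is called reducible (respectively irreducible) if $\mathcal{V}$ is reducible (respectively irreducible) as an $\mathbb{F}_q\langle g_1,g_2\rangle$-module. *)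

theory Defs
  imports
    "HOL-Analysis.Determinants"
    "HOL-Algebra.Generated_Groups"
begin

text \<open>
  The field of order \<open>q\<close> is a type \<open>'a\<close> of classes \<open>field\<close> and \<open>finite\<close>, with \<open>q = CARD('a)\<close>;
  the degree is \<open>d = CARD('n)\<close>. Vectors in \<open>'a ^ 'n\<close> are read as row vectors: a matrix \<open>A\<close> sends
  \<open>v\<close> to \<open>v v* A\<close>.
\<close>

definition GL :: "('a::field ^ 'n::finite ^ 'n) monoid" where
  "GL = \<lparr>carrier = {A. invertible A}, monoid.mult = (**), one = mat 1\<rparr>"

definition SL :: "('a::field ^ 'n::finite ^ 'n) set" where
  "SL = {A. det A = 1}"

lemma group_GL: "group (GL :: ('a::field ^ 'n::finite ^ 'n) monoid)"
proof (rule groupI)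
  fix A :: "'a ^ 'n ^ 'n"
  assume "A \<in> carrier GL"
  then obtain B where "A ** B = mat 1" "B ** A = mat 1"
    by (auto simp: GL_def invertible_def)
  then show "\<exists>B\<in>carrier GL. B \<otimes>\<^bsub>GL\<^esub> A = \<one>\<^bsub>GL\<^esub>"
    by (auto simp: GL_def invertible_def)
qed (auto simp: GL_def det_mul matrix_mul_assoc invertible_det_nz)

lemma subgroup_SL: "subgroup SL (GL :: ('a::field ^ 'n::finite ^ 'n) monoid)"
proof (rule group.subgroupI[OF group_GL])
  show "SL \<subseteq> carrier (GL :: ('a ^ 'n ^ 'n) monoid)"
    by (auto simp: SL_def GL_def invertible_det_nz)
  show "(SL :: ('a ^ 'n ^ 'n) set) \<noteq> {}"
    by (auto simp: SL_def intro: exI[of _ "mat 1"])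
next
  fix A :: "'a ^ 'n ^ 'n"
  assume A: "A \<in> SL"
  then have "A \<in> carrier GL"
    by (auto simp: SL_def GL_def invertible_det_nz)
  then have "inv\<^bsub>GL\<^esub> A \<otimes>\<^bsub>GL\<^esub> A = \<one>\<^bsub>GL\<^esub>"
    by (rule group.l_inv[OF group_GL])
  then have "det (inv\<^bsub>GL\<^esub> A) * det A = 1"
    by (metis (no_types, lifting) GL_def det_I det_mul monoid.select_convs(1) monoid.select_convs(2))
  with A show "inv\<^bsub>GL\<^esub> A \<in> SL"
    by (simp add: SL_def)
qed (auto simp: SL_def GL_def det_mul)

definition submodule :: "('a::field ^ 'n ^ 'n) set \<Rightarrow> ('a ^ 'n::finite) set \<Rightarrow> bool" where
  "submodule H W \<longleftrightarrow> vec.subspace W \<and> (\<forall>h\<in>H. \<forall>w\<in>W. w v* h \<in> W)"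

definition irreducible_submodule :: "('a::field ^ 'n ^ 'n) set \<Rightarrow> ('a ^ 'n::finite) set \<Rightarrow> bool" where
  "irreducible_submodule H W \<longleftrightarrow>
     submodule H W \<and> W \<noteq> {0} \<and> (\<forall>U. submodule H U \<and> U \<subseteq> W \<longrightarrow> U = {0} \<or> U = W)"

definition fat :: "'a::field ^ 'n::finite ^ 'n \<Rightarrow> bool" where
  "fat g \<longleftrightarrow>
     (\<exists>W. irreducible_submodule (generate GL {g}) W \<and> real (vec.dim W) > real CARD('n) / 2)"

definition irreducible_pair :: "('a::field ^ 'n::finite ^ 'n) \<times> ('a ^ 'n ^ 'n) \<Rightarrow> bool" where
  "irreducible_pair = (\<lambda>(g1, g2). irreducible_submodule (generate GL {g1, g2}) UNIV)"

definition reducible_pair :: "('a::field ^ 'n::finite ^ 'n) \<times> ('a ^ 'n ^ 'n) \<Rightarrow> bool" where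
  "reducible_pair p \<longleftrightarrow> \<not> irreducible_pair p"

definition fat_pairs :: "('a::field ^ 'n::finite ^ 'n) set \<Rightarrow> (('a ^ 'n ^ 'n) \<times> ('a ^ 'n ^ 'n)) set" where
  "fat_pairs G = {(g1, g2) \<in> G \<times> G. fat g1 \<and> fat g2}"

definition kappa :: "('a::{field,finite} ^ 'n::finite ^ 'n) set \<Rightarrow> real" where
  "kappa G = real (card {p \<in> fat_pairs G. reducible_pair p}) / real (card (fat_pairs G))"

end

theory Submission
  imports Defs
begin

text \<open>
  A fat element has exactly one irreducible submodule of dimension more than \<open>d/2\<close>, because two such
  submodules meet nontrivially; call it the heart of the element. A subspace invariant under a fat
  element either contains its heart or meets it trivially. If a proper nonzero subspace \<open>U\<close> is
  invariant under two fat elements, then both elements behave in the same way towards \<open>U\<close>: containing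
  a heart forces \<open>dim U > d/2\<close> and meeting one trivially forces \<open>dim U < d/2\<close>. So reducible fat pairs
  can be counted by the pairs \<open>(g1, g2)\<close> that share an incidence of the same kind with some \<open>U\<close>, where
  \<open>g\<close> and \<open>U\<close> are incident if \<open>U\<close> is \<open>g\<close>-invariant and lies in the prescribed position (containing or
  trivially meeting) relative to the heart of \<open>g\<close>.

  Fix the kind and the dimension \<open>k\<close> of \<open>U\<close>, and let \<open>F\<close> be the number of fat elements of \<open>G\<close>. There are
  at most \<open>F\<close> incidences (\<open>card_incidences_le\<close>). This is an orbit-counting argument on the coset of
  elements that act on a heart \<open>W\<close> in a given way: the pointwise stabilizer of \<open>W\<close> in the special linear
  group is transitive on the admissible \<open>U\<close> (\<open>SL_transitive_fixing\<close>), so on average an element of the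
  coset fixes at most one of them. By conjugation all \<open>k\<close>-dimensional \<open>U\<close> are incident with
  equally many elements, hence with at most \<open>F / S\<close> of them, where \<open>S\<close> is the number of \<open>k\<close>-dimensional
  subspaces. Therefore at most \<open>S (F / S)\<^sup>2 = F\<^sup>2 / S\<close> pairs share an incidence
  (\<open>card_sharing_pairs_le\<close>), and the proportion of such pairs among all fat pairs is at most \<open>1 / S\<close>.

  What remains is a sum over \<open>1 \<le> k < d/2\<close>, with one term for subspaces of dimension \<open>d - k\<close> containing
  the hearts and one for subspaces of dimension \<open>k\<close> meeting them trivially. Both times
  \<open>S \<ge> q\<^bsup>k(d-k)\<^esup> (1 + 1/q)\<close> (\<open>card_Grassmannian_ge\<close>). The term \<open>k = 1\<close> accounts for
  \<open>q\<^bsup>-(d-1)\<^esup> / (1 + 1/q)\<close>, and the later terms decay so fast that together they do not use up the factor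
  \<open>1 + 1/q\<close> (\<open>Gaussian_exponent_sum_less\<close>). The two kinds give the factor 2.
\<close>

section \<open>Matrices acting on row vectors\<close>

lemma vec_linear_mult_right: "Vector_Spaces.linear (*s) (*s) (\<lambda>v::'a::field ^ 'n. v v* A)"
  by unfold_locales (simp_all add: vector_matrix_left_distrib scalar_vector_matrix_assoc)

lemma inj_mult_right:
  assumes "invertible (A :: 'a::field ^ 'n ^ 'n)"
  shows "inj (\<lambda>v. v v* A)"
proof -
  from assms obtain B where "A ** B = mat 1"
    by (auto simp: invertible_def)
  then have "(v v* A) v* B = v" for v
    by (simp add: vector_matrix_mul_assoc)
  then show ?thesis
    by (metis injI)
qed

lemma span_image_mult_right:
  "vec.span ((\<lambda>v::'a::field ^ 'n. v v* A) ` S) = (\<lambda>v. v v* A) ` vec.span S"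
proof -
  interpret l: Vector_Spaces.linear "(*s)" "(*s)" "\<lambda>v::'a ^ 'n. v v* A"
    by (rule vec_linear_mult_right)
  show ?thesis by (rule l.span_image)
qed

lemma subspace_image_mult_right:
  "vec.subspace U \<Longrightarrow> vec.subspace ((\<lambda>v::'a::field ^ 'n. v v* A) ` U)"
  by (metis span_image_mult_right vec.span_eq_iff)

lemma dim_image_mult_right:
  assumes "invertible (A :: 'a::field ^ 'n ^ 'n)"
  shows "vec.dim ((\<lambda>v. v v* A) ` U) = vec.dim U"
  using assms
  by (intro vec.dim_image_eq vec_linear_mult_right inj_on_subset[OF inj_mult_right]) auto

lemma image_mult_right_mult:
  "(\<lambda>v. v v* (A ** B)) ` U = (\<lambda>v. v v* B) ` (\<lambda>v. v v* (A :: 'a::field ^ 'n ^ 'n)) ` U"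
  by (simp add: image_image vector_matrix_mul_assoc)

lemma axis_mult_right: "axis i 1 v* A = (A :: 'a::field ^ 'n ^ 'n) $ i"
  by (simp add: vec_eq_iff vector_matrix_mult_def axis_def if_distrib if_distribR cong: if_cong)

lemma invertible_if_rows_span:
  assumes "vec.span (range (($) (A :: 'a::field ^ 'n ^ 'n))) = UNIV"
  shows "invertible A"
proof -
  have "rows A = range (($) A)"
    by (auto simp: rows_def row_def vec_lambda_eta)
  with assms show ?thesis
    by (metis invertible_left_inverse matrix_left_invertible_span_rows_gen)
qed

section \<open>Transitivity of the special linear group on subspaces\<close>

text \<open>
  Rescaling the image of a single basis vector \<open>b0\<close> adjusts the determinant to 1. Spans of images of
  basis vectors do not notice the factor \<open>c\<close>, so only the choice of \<open>b0\<close> matters later.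
\<close>

lemma basis_change_det_1:
  fixes B B' :: "('a::field ^ 'n) set"
  assumes B: "vec.independent B" "vec.span B = UNIV"
    and B': "vec.span B' = UNIV"
    and f: "bij_betw f B B'" and b0: "b0 \<in> B"
  obtains A c where "det A = 1" "c \<noteq> 0"
    "\<And>b. b \<in> B \<Longrightarrow> b v* A = (if b = b0 then c *s f b else f b)"
proof -
  have "card B = CARD('n)" "finite B"
    using B vec.dim_eq_card_independent[OF B(1)] vec.finiteI_independent[OF B(1)]
    by (metis vec.dim_span vec_dim_card, simp)
  then obtain \<beta> :: "'n \<Rightarrow> _" where \<beta>: "bij_betw \<beta> UNIV B"
    by (metis finite_class.finite_UNIV finite_same_card_bij)
  then have r\<beta>: "range \<beta> = B"
    by (simp add: bij_betw_def)
  obtain j where j: "\<beta> j = b0"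
    using b0 r\<beta> by auto
  have j_iff: "i = j \<longleftrightarrow> \<beta> i = b0" for i
    using \<beta> j by (auto simp: bij_betw_def inj_def)
  define P where "P = (\<chi> i. \<beta> i)"
  define Q where "Q = (\<chi> i. f (\<beta> i))"
  have "range (($) P) = B" "range (($) Q) = B'"
    using r\<beta> f by (auto simp: P_def Q_def bij_betw_def image_iff)
  then have inv: "invertible P" "invertible Q"
    using B(2) B' by (auto intro: invertible_if_rows_span)
  \<comment> \<open>The factor that gives the rescaled target basis the determinant of the source basis.\<close>
  define c where "c = det P / det Q"
  define R where "R = (\<chi> i. if i = j then c *s f (\<beta> i) else f (\<beta> i))"
  have "det R = c * det Q"
    unfolding R_def Q_def by (subst det_row_mul) simp
  then have detR: "det R = det P"
    using inv by (simp add: c_def invertible_det_nz)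
  obtain P' where P': "P' ** P = mat 1" "P ** P' = mat 1"
    using inv(1) by (auto simp: invertible_def)
  show thesis
  proof
    show "det (P' ** R) = 1"
      by (metis P'(1) det_I det_mul detR)
    show "c \<noteq> 0"
      using inv by (simp add: c_def invertible_det_nz)
    fix b assume "b \<in> B"
    then obtain i where i: "b = \<beta> i"
      using r\<beta> by auto
    have "b = axis i 1 v* P"
      by (simp add: axis_mult_right P_def i)
    then have "b v* (P' ** R) = axis i 1 v* (P ** (P' ** R))"
      by (simp add: vector_matrix_mul_assoc)
    also have "P ** (P' ** R) = R"
      by (simp add: matrix_mul_assoc P')
    also have "axis i 1 v* R = (if b = b0 then c *s f b else f b)"
      by (simp add: axis_mult_right R_def i j_iff)
    finally show "b v* (P' ** R) = (if b = b0 then c *s f b else f b)" .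
  qed
qed

text \<open>
  A basis \<open>C\<close> of \<open>W\<close> that contains a basis \<open>C0\<close> of \<open>W \<inter> U\<close> extends to a basis of the whole space from
  which a basis of \<open>U\<close> can be read off. The union of the two bases spans \<open>W + U\<close> and has the right size
  to be independent.
\<close>

lemma adapted_basis:
  fixes W U :: "('a::field ^ 'n) set"
  assumes sub: "vec.subspace W" "vec.subspace U"
    and C: "C \<subseteq> W" "vec.independent C" "vec.span C = W"
      "C0 \<subseteq> C" "vec.span C0 = W \<inter> U"
  obtains D E where "vec.span (C0 \<union> D) = U" "C \<inter> D = {}" "(C \<union> D) \<inter> E = {}"
    "vec.independent (C \<union> D \<union> E)" "vec.span (C \<union> D \<union> E) = UNIV"
    "card D = vec.dim U - vec.dim (W \<inter> U)"
proof -
  have iC0: "vec.independent C0"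
    using C vec.independent_mono by blast
  have C0U: "C0 \<subseteq> U"
    using C vec.span_superset by blast
  obtain F where F: "C0 \<subseteq> F" "F \<subseteq> U" "vec.independent F" "U \<subseteq> vec.span F"
    using vec.maximal_independent_subset_extend[OF C0U iC0] by metis
  have spF: "vec.span F = U"
    using F sub by (metis vec.span_subspace)
  define D where "D = F - C0"
  have F_eq: "F = C0 \<union> D"
    using F D_def by auto
  have CD: "C \<inter> D = {}"
  proof -
    have "x \<in> C0" if "x \<in> C" "x \<in> F" for x
    proof (rule ccontr)
      assume "x \<notin> C0"
      have "x \<in> vec.span C0"
        using that C F by auto
      then have "x \<in> vec.span (C - {x})"
        using \<open>x \<notin> C0\<close> C(4) vec.span_mono[of C0 "C - {x}"] by auto
      then show False
        using C(2) that(1) by (auto simp: vec.dependent_def)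
    qed
    then show ?thesis by (auto simp: D_def)
  qed
  have fin: "finite C" "finite F" "finite D"
    using C(2) F(3) vec.finiteI_independent F_eq by auto
  have cards: "card C = vec.dim W" "card F = vec.dim U" "card C0 = vec.dim (W \<inter> U)"
    using vec.dim_span_eq_card_independent C F iC0 spF by metis+
  have cD: "card D = vec.dim U - vec.dim (W \<inter> U)"
    using cards F(1) fin by (simp add: D_def card_Diff_subset finite_subset)
  have le: "vec.dim (W \<inter> U) \<le> vec.dim U"
    by (rule vec.dim_subset) simp
  define S where "S = {x + y | x y. x \<in> W \<and> y \<in> U}"
  have "vec.dim S + vec.dim (W \<inter> U) = vec.dim W + vec.dim U"
    unfolding S_def by (rule vec.dim_sums_Int[OF sub])
  then have "card (C \<union> D) \<le> vec.dim S"
    using CD fin cards cD le by (simp add: card_Un_disjoint)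
  moreover have sS: "vec.span (C \<union> D) = S"
  proof -
    have "vec.span (C \<union> D) = vec.span (C \<union> F)"
      using C(4) F_eq by (simp add: sup.absorb1 flip: sup_assoc)
    then show ?thesis
      unfolding S_def vec.span_Un spF C(3) by auto
  qed
  moreover have "C \<union> D \<subseteq> S"
    using sS vec.span_superset by blast
  ultimately have ind: "vec.independent (C \<union> D)"
    using fin by (intro vec.card_le_dim_spanning[of "C \<union> D" S]) auto
  then obtain G where G: "C \<union> D \<subseteq> G" "vec.independent G" "UNIV \<subseteq> vec.span G"
    using vec.maximal_independent_subset_extend[OF subset_UNIV ind] by metis
  show thesis
  proof
    show "vec.span (C0 \<union> D) = U" "C \<inter> D = {}" "card D = vec.dim U - vec.dim (W \<inter> U)"
      using spF F_eq CD cD by auto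
    show "(C \<union> D) \<inter> (G - (C \<union> D)) = {}" by auto
    have "C \<union> D \<union> (G - (C \<union> D)) = G" using G by auto
    then show "vec.independent (C \<union> D \<union> (G - (C \<union> D)))"
      "vec.span (C \<union> D \<union> (G - (C \<union> D))) = UNIV"
      using G by auto
  qed
qed

text \<open>
  Bases adapted to \<open>(W, U)\<close> and to \<open>(W, U')\<close> can share their part in \<open>W\<close>; the matrix matching them fixes
  \<open>W\<close> pointwise. Since \<open>W\<close> is proper, some basis vector outside \<open>W\<close> is free to absorb the determinant.
\<close>

lemma SL_transitive_fixing:
  fixes W U U' :: "('a::field ^ 'n) set"
  assumes sub: "vec.subspace W" "vec.subspace U" "vec.subspace U'"
    and W: "W \<noteq> UNIV"
    and dim: "vec.dim U = vec.dim U'"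
    and Int: "W \<inter> U = W \<inter> U'"
  obtains A where "A \<in> SL" "\<And>w. w \<in> W \<Longrightarrow> w v* A = w" "(\<lambda>v. v v* A) ` U = U'"
proof -
  have sI: "vec.subspace (W \<inter> U)"
    using sub vec.subspace_inter by blast
  then obtain C0 where C0: "C0 \<subseteq> W \<inter> U" "vec.independent C0" "vec.span C0 = W \<inter> U"
    using vec.basis_subspace_exists by metis
  then have C0W: "C0 \<subseteq> W" by auto
  obtain C where C: "C0 \<subseteq> C" "C \<subseteq> W" "vec.independent C" "W \<subseteq> vec.span C"
    using vec.maximal_independent_subset_extend[OF C0W C0(2)] by metis
  then have spC: "vec.span C = W"
    using sub by (metis vec.span_subspace)
  obtain D E where DE: "vec.span (C0 \<union> D) = U" "C \<inter> D = {}" "(C \<union> D) \<inter> E = {}"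
    "vec.independent (C \<union> D \<union> E)" "vec.span (C \<union> D \<union> E) = UNIV"
    "card D = vec.dim U - vec.dim (W \<inter> U)"
    using adapted_basis[OF sub(1,2) C(2,3) spC C(1) C0(3)] by metis
  obtain D' E' where DE': "vec.span (C0 \<union> D') = U'" "C \<inter> D' = {}" "(C \<union> D') \<inter> E' = {}"
    "vec.independent (C \<union> D' \<union> E')" "vec.span (C \<union> D' \<union> E') = UNIV"
    "card D' = vec.dim U' - vec.dim (W \<inter> U')"
    using adapted_basis[OF sub(1,3) C(2,3) spC C(1)] C0(3) Int by metis
  have fin: "finite C" "finite D" "finite E" "finite D'" "finite E'"
    using DE(4) DE'(4) vec.finiteI_independent by (metis finite_Un)+
  have cD: "card D = card D'"
    using DE(6) DE'(6) dim Int by simp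
  have "card (C \<union> D \<union> E) = card (C \<union> D' \<union> E')"
    using DE(4,5) DE'(4,5) by (metis vec.dim_span_eq_card_independent)
  then have cE: "card E = card E'"
    using DE(2,3) DE'(2,3) fin cD by (simp add: card_Un_disjoint)
  obtain g where g: "bij_betw g D D'"
    using cD fin finite_same_card_bij by metis
  obtain h where h: "bij_betw h E E'"
    using cE fin finite_same_card_bij by metis
  define f where "f v = (if v \<in> C then v else if v \<in> D then g v else h v)" for v
  have fC: "bij_betw f C C"
    using bij_betw_cong[of C id f C] by (auto simp: f_def)
  have fD: "bij_betw f D D'"
    using g DE(2) by (subst bij_betw_cong[of D f g]) (auto simp: f_def)
  have fE: "bij_betw f E E'"
    using h DE(3) by (subst bij_betw_cong[of E f h]) (auto simp: f_def)
  have f: "bij_betw f (C \<union> D \<union> E) (C \<union> D' \<union> E')"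
    by (intro bij_betw_combine fC fD fE DE'(2,3))
  have "\<exists>b0. b0 \<in> D \<union> E"
    using W DE(5) spC by (metis sup_bot_right Un_empty sup_assoc ex_in_conv)
  then obtain b0 where b0: "b0 \<in> D \<union> E" ..
  then have b0C: "b0 \<in> C \<union> D \<union> E" by auto
  have b0C': "b0 \<notin> C" using b0 DE by auto
  obtain A c where A: "det A = 1" "c \<noteq> 0"
    "\<And>b. b \<in> C \<union> D \<union> E \<Longrightarrow> b v* A = (if b = b0 then c *s f b else f b)"
    using basis_change_det_1[OF DE(4,5) DE'(5) f b0C] by metis
  interpret l: Vector_Spaces.linear "(*s)" "(*s)" "\<lambda>v::'a ^ 'n. v v* A"
    by (rule vec_linear_mult_right)
  have AC: "b v* A = b" if "b \<in> C" for b
    using that b0C' A(3)[of b] by (auto simp: f_def)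
  show thesis
  proof
    show "A \<in> SL" using A by (simp add: SL_def)
    have inv: "invertible A" using A by (simp add: invertible_det_nz)
    show "w v* A = w" if "w \<in> W" for w
    proof -
      have "w v* A = id w"
        using vec.linear_eq_on[OF vec_linear_mult_right vec.linear_id, of w C A] that AC spC
        by simp
      then show ?thesis by simp
    qed
    have "(\<lambda>v. v v* A) ` (C0 \<union> D) \<subseteq> vec.span (C0 \<union> D')"
    proof
      fix x assume "x \<in> (\<lambda>v. v v* A) ` (C0 \<union> D)"
      then obtain b where b: "b \<in> C0 \<union> D" "x = b v* A" by auto
      have "f b \<in> C0 \<union> D'"
        using b(1) C(1) fD by (auto simp: f_def bij_betw_def)
      then have "f b \<in> vec.span (C0 \<union> D')"
        by (rule vec.span_base)
      moreover have "b \<in> C \<union> D \<union> E"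
        using b(1) C(1) by auto
      then have "x = c *s f b \<or> x = f b"
        using A(3) b(2) by auto
      ultimately show "x \<in> vec.span (C0 \<union> D')"
        by (auto intro: vec.span_scale)
    qed
    then have "vec.span ((\<lambda>v. v v* A) ` (C0 \<union> D)) \<subseteq> U'"
      using DE'(1) by (metis vec.span_minimal vec.subspace_span)
    then have "(\<lambda>v. v v* A) ` U \<subseteq> U'"
      by (simp add: span_image_mult_right DE(1))
    then show "(\<lambda>v. v v* A) ` U = U'"
      using sub dim by (intro vec.subspace_dim_equal subspace_image_mult_right)
        (simp_all add: dim_image_mult_right[OF inv])
  qed
qed

section \<open>Counting subspaces\<close>

lemma card_span_independent:
  fixes B :: "('a::{field,finite} ^ 'n) set"
  assumes "vec.independent B"
  shows "card (vec.span B) = CARD('a) ^ card B"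
proof -
  have "finite B" using assms vec.finiteI_independent by blast
  then show ?thesis
    using assms
  proof (induction B)
    case empty
    then show ?case by simp
  next
    case (insert a B)
    then have ind: "vec.independent B" "a \<notin> vec.span B"
      by (auto simp: vec.independent_insert)
    let ?f = "\<lambda>(k, x). k *s a + x"
    have "vec.span (insert a B) = ?f ` (UNIV \<times> vec.span B)"
    proof (intro Set.set_eqI iffI)
      fix y assume "y \<in> vec.span (insert a B)"
      then obtain k where "y - k *s a \<in> vec.span B"
        by (auto simp: vec.span_breakdown_eq)
      then show "y \<in> ?f ` (UNIV \<times> vec.span B)"
        by (intro image_eqI[of _ _ "(k, y - k *s a)"]) auto
    next
      fix y assume "y \<in> ?f ` (UNIV \<times> vec.span B)"
      then obtain k x where "y = k *s a + x" "x \<in> vec.span B" by auto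
      then have "y - k *s a \<in> vec.span B" by simp
      then show "y \<in> vec.span (insert a B)"
        by (auto simp: vec.span_breakdown_eq)
    qed
    moreover have "inj_on ?f (UNIV \<times> vec.span B)"
    proof (intro inj_onI, clarsimp)
      fix k x l y
      assume xy: "x \<in> vec.span B" "y \<in> vec.span B" and eq: "k *s a + x = l *s a + y"
      have e: "(k - l) *s a = y - x"
        using eq by (simp add: vec.scale_left_diff_distrib algebra_simps)
      have "k = l"
      proof (rule ccontr)
        assume "k \<noteq> l"
        have "(k - l) *s a \<in> vec.span B"
          unfolding e using xy by (intro vec.span_diff)
        then have "inverse (k - l) *s ((k - l) *s a) \<in> vec.span B"
          by (rule vec.span_scale)
        then show False
          using \<open>k \<noteq> l\<close> ind by simp
      qed
      then show "k = l \<and> x = y" using eq by simp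
    qed
    ultimately show ?case
      using insert ind by (simp add: card_image card_cartesian_product)
  qed
qed

lemma card_subspace:
  fixes S :: "('a::{field,finite} ^ 'n) set"
  assumes "vec.subspace S"
  shows "card S = CARD('a) ^ vec.dim S"
  using assms card_span_independent by (metis vec.basis_subspace_exists)

text \<open>
  Ordered bases count subspaces: each \<open>k\<close>-dimensional subspace accounts for the same number of
  independent lists of length \<open>k\<close>.
\<close>

definition independent_lists :: "('a::field ^ 'n) set \<Rightarrow> nat \<Rightarrow> ('a ^ 'n) list set" where
  "independent_lists S k =
     {xs. length xs = k \<and> distinct xs \<and> vec.independent (set xs) \<and> set xs \<subseteq> S}"

lemma card_independent_lists:
  fixes S :: "('a::{field,finite} ^ 'n) set"
  assumes "vec.subspace S"
  shows "card (independent_lists S k) = (\<Prod>i<k. CARD('a) ^ vec.dim S - CARD('a) ^ i)"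
proof (induction k)
  case 0
  have "independent_lists S 0 = {[]}"
    by (auto simp: independent_lists_def vec.independent_empty)
  then show ?case by simp
next
  case (Suc k)
  have eq: "independent_lists S (Suc k) =
      (\<lambda>(xs, x). x # xs) ` (SIGMA xs:independent_lists S k. S - vec.span (set xs))"
    (is "_ = ?f ` ?P")
  proof (intro Set.set_eqI iffI)
    fix ys assume "ys \<in> independent_lists S (Suc k)"
    then obtain x xs where "ys = x # xs" "(xs, x) \<in> ?P"
      by (cases ys) (auto simp: independent_lists_def vec.independent_insert)
    then show "ys \<in> ?f ` ?P" by (intro image_eqI[of _ _ "(xs, x)"]) auto
  next
    fix ys assume "ys \<in> ?f ` ?P"
    then obtain xs x where x: "ys = x # xs" "xs \<in> independent_lists S k" "x \<in> S"
      "x \<notin> vec.span (set xs)" by auto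
    then have "x \<notin> set xs" using vec.span_base by blast
    then show "ys \<in> independent_lists S (Suc k)"
      using x by (auto simp: independent_lists_def vec.independent_insert)
  qed
  have fin: "finite (independent_lists S k)"
    by (rule finite_subset[OF _ finite_lists_length_eq[of UNIV k]])
      (auto simp: independent_lists_def)
  have c: "card (S - vec.span (set xs)) = CARD('a) ^ vec.dim S - CARD('a) ^ k"
    if "xs \<in> independent_lists S k" for xs
  proof -
    have xs: "set xs \<subseteq> S" "vec.independent (set xs)" "card (set xs) = k"
      using that by (auto simp: independent_lists_def distinct_card)
    then have "vec.span (set xs) \<subseteq> S"
      using assms by (metis vec.span_minimal)
    then show ?thesis
      using xs by (simp add: card_Diff_subset card_span_independent card_subspace[OF assms])
  qed
  have "inj_on ?f ?P" by (auto simp: inj_on_def)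
  then have "card (independent_lists S (Suc k)) = card ?P"
    unfolding eq by (rule card_image)
  also have "\<dots> = (\<Sum>xs\<in>independent_lists S k. card (S - vec.span (set xs)))"
    using fin by (simp add: card_SigmaI)
  also have "\<dots> = card (independent_lists S k) * (CARD('a) ^ vec.dim S - CARD('a) ^ k)"
    using c by simp
  finally show ?case
    using Suc by (simp add: mult.commute)
qed

definition Grassmannian :: "nat \<Rightarrow> ('a::field ^ 'n) set set" where
  "Grassmannian k = {U. vec.subspace U \<and> vec.dim U = k}"

lemma card_Grassmannian_mult:
  "card (Grassmannian k :: ('a::{field,finite} ^ 'n) set set) * (\<Prod>i<k. CARD('a) ^ k - CARD('a) ^ i)
     = (\<Prod>i<k. CARD('a) ^ CARD('n) - CARD('a) ^ i)"
proof -
  let ?Gr = "Grassmannian k :: ('a ^ 'n) set set"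
  have span: "vec.span (set xs) = U"
    if "U \<in> ?Gr" "xs \<in> independent_lists U k" for U xs
  proof (rule vec.subspace_dim_equal)
    show "vec.dim (vec.span (set xs)) \<ge> vec.dim U"
      using that by (simp add: Grassmannian_def independent_lists_def
          vec.dim_eq_card_independent distinct_card)
    show "vec.span (set xs) \<subseteq> U"
      using that by (auto simp: Grassmannian_def independent_lists_def dest: vec.span_minimal)
  qed (use that in \<open>auto simp: Grassmannian_def\<close>)
  have "independent_lists (UNIV :: ('a ^ 'n) set) k = (\<Union>U\<in>?Gr. independent_lists U k)"
  proof (intro Set.set_eqI iffI)
    fix xs :: "('a ^ 'n) list" assume xs: "xs \<in> independent_lists UNIV k"
    then have "vec.span (set xs) \<in> ?Gr" "xs \<in> independent_lists (vec.span (set xs)) k"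
      by (auto simp: independent_lists_def Grassmannian_def vec.dim_span_eq_card_independent
          distinct_card vec.span_base simp del: vec.dim_span)
    then show "xs \<in> (\<Union>U\<in>?Gr. independent_lists U k)" by blast
  qed (auto simp: independent_lists_def)
  moreover have "card (\<Union>U\<in>?Gr. independent_lists U k) = (\<Sum>U\<in>?Gr. card (independent_lists U k))"
  proof (intro card_UN_disjoint ballI impI)
    show "finite (independent_lists U k)" for U :: "('a ^ 'n) set"
      by (rule finite_subset[OF _ finite_lists_length_eq[of UNIV k]])
        (auto simp: independent_lists_def)
    show "independent_lists U k \<inter> independent_lists U' k = {}"
      if "U \<in> ?Gr" "U' \<in> ?Gr" "U \<noteq> U'" for U U'
      using that span by blast
  qed simp
  moreover have "card (independent_lists U k) = (\<Prod>i<k. CARD('a) ^ k - CARD('a) ^ i)"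
    if "U \<in> ?Gr" for U
    using that by (simp add: Grassmannian_def card_independent_lists)
  ultimately have "card (independent_lists (UNIV :: ('a ^ 'n) set) k)
      = card ?Gr * (\<Prod>i<k. CARD('a) ^ k - CARD('a) ^ i)"
    by simp
  then show ?thesis
    by (simp add: card_independent_lists card_cart_basis)
qed

lemma two_le_card_field: "2 \<le> CARD('a::{field,finite})"
proof -
  have "card {0, 1 :: 'a} \<le> CARD('a)"
    by (rule card_mono) auto
  then show ?thesis by simp
qed

text \<open>
  Every factor satisfies \<open>q\<^bsup>d\<^esup> - q\<^bsup>i\<^esup> \<ge> q\<^bsup>d-k\<^esup> (q\<^bsup>k\<^esup> - q\<^bsup>i\<^esup>)\<close>, which gives the power of \<open>q\<close>. The gain \<open>1 + 1/q\<close>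
  comes from the last factor \<open>i = k - 1\<close> alone: there the quotient is
  \<open>(q\<^bsup>d-k+1\<^esup> - 1) / (q - 1) = q\<^bsup>d-k\<^esup> + q\<^bsup>d-k-1\<^esup> + ...\<close>, with at least two terms.
\<close>

lemma Grassmannian_product_bound:
  fixes q :: real
  assumes "q > 1" "0 < k" "k < d"
  shows "q ^ (k * (d - k)) * (1 + 1 / q) * (\<Prod>i<k. q ^ k - q ^ i) \<le> (\<Prod>i<k. q ^ d - q ^ i)"
proof -
  obtain m where k: "k = Suc m" using assms by (cases k) auto
  define e where "e = d - k - 1"
  have d: "d = Suc (m + Suc e)" using assms k by (simp add: e_def)
  have dk: "d - k = Suc e" by (simp add: d k)
  have pos: "0 \<le> q ^ (d - k) * (q ^ k - q ^ i)" if "i < k" for i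
    using assms that by (simp add: power_increasing)
  have "q ^ (k * (d - k)) * (1 + 1 / q) * (\<Prod>i<k. q ^ k - q ^ i)
      = (\<Prod>i<k. q ^ (d - k)) * (1 + 1 / q) * (\<Prod>i<k. q ^ k - q ^ i)"
    by (simp add: mult.commute flip: power_mult)
  also have "\<dots> = (1 + 1 / q) * (\<Prod>i<k. q ^ (d - k) * (q ^ k - q ^ i))"
    by (simp add: prod.distrib)
  also have "\<dots> = (1 + 1 / q) * (q ^ (d - k) * (q ^ k - q ^ m)) * (\<Prod>i<m. q ^ (d - k) * (q ^ k - q ^ i))"
    by (simp add: k lessThan_Suc)
  also have "\<dots> \<le> (q ^ d - q ^ m) * (\<Prod>i<m. q ^ d - q ^ i)"
  proof (intro mult_mono prod_mono conjI)
    have "(1 + 1 / q) * (q ^ (d - k) * (q ^ k - q ^ m)) = q ^ m * (q ^ e * (q\<^sup>2 - 1))"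
      unfolding dk using assms by (simp add: k field_simps power2_eq_square)
    also have "\<dots> = q ^ d - q ^ m * q ^ e"
      by (simp add: d power_add algebra_simps power2_eq_square)
    also have "\<dots> \<le> q ^ d - q ^ m"
      using assms by simp
    finally show "(1 + 1 / q) * (q ^ (d - k) * (q ^ k - q ^ m)) \<le> q ^ d - q ^ m" .
    show "0 \<le> q ^ d - q ^ m"
      using assms k by (simp add: power_increasing)
    fix i assume "i \<in> {..<m}"
    then have "i < k" by (simp add: k)
    then show "0 \<le> q ^ (d - k) * (q ^ k - q ^ i)"
      by (rule pos)
    have "q ^ (d - k) * (q ^ k - q ^ i) = q ^ d - q ^ (d - k) * q ^ i"
      using assms by (simp add: right_diff_distrib flip: power_add)
    also have "\<dots> \<le> q ^ d - q ^ i"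
      using assms by simp
    finally show "q ^ (d - k) * (q ^ k - q ^ i) \<le> q ^ d - q ^ i" .
  next
    show "0 \<le> (\<Prod>i<m. q ^ (d - k) * (q ^ k - q ^ i))"
    proof (rule prod_nonneg)
      fix i assume "i \<in> {..<m}"
      then have "i < k" by (simp add: k)
      then show "0 \<le> q ^ (d - k) * (q ^ k - q ^ i)" by (rule pos)
    qed
  qed
  also have "\<dots> = (\<Prod>i<k. q ^ d - q ^ i)"
    by (simp add: k lessThan_Suc)
  finally show ?thesis .
qed

text \<open>
  The factor \<open>1 + 1/q\<close> cannot be dropped: with the bound \<open>q\<^bsup>k(d-k)\<^esup>\<close> alone, the term \<open>k = 1\<close> would already
  exhaust the target \<open>q\<^bsup>-(d-1)\<^esup>\<close>.
\<close>

lemma card_Grassmannian_ge: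
  assumes "0 < k" "k < CARD('n)"
  shows "real CARD('a) ^ (k * (CARD('n) - k)) * (1 + 1 / real CARD('a))
    \<le> real (card (Grassmannian k :: ('a::{field,finite} ^ 'n) set set))"
proof -
  define q where "q = real CARD('a)"
  let ?P = "\<Prod>i<k. q ^ k - q ^ i"
  have q: "q > 1"
    using two_le_card_field[where 'a = 'a] by (simp add: q_def)
  have real: "real (\<Prod>i<k. CARD('a) ^ m - CARD('a) ^ i) = (\<Prod>i<k. q ^ m - q ^ i)" if "k \<le> m" for m
    unfolding of_nat_prod q_def
    using that two_le_card_field[where 'a = 'a]
    by (intro prod.cong) (auto simp: of_nat_diff power_increasing)
  have "?P > 0"
    using q by (intro prod_pos) (auto intro: power_strict_increasing)
  have "q ^ (k * (CARD('n) - k)) * (1 + 1 / q) * ?P \<le> (\<Prod>i<k. q ^ CARD('n) - q ^ i)"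
    by (rule Grassmannian_product_bound[OF q assms])
  also have "\<dots> = real (card (Grassmannian k :: ('a ^ 'n) set set)) * ?P"
    using card_Grassmannian_mult[where 'a = 'a and 'n = 'n, of k] real assms
    by (metis less_imp_le of_nat_mult order_refl)
  finally show ?thesis
    using \<open>?P > 0\<close> by (simp add: q_def mult_le_cancel_right)
qed

text \<open>
  For \<open>2 \<le> k < d/2\<close> the exponent is at least \<open>d - 1 + k\<close>, because
  \<open>k (d - k) - (d - 1) = (k - 1) (d - k - 1)\<close> and \<open>d - k - 1 \<ge> k\<close>. So the terms after the first are
  dominated by a geometric series with sum less than \<open>1/q\<close>.
\<close>

lemma Gaussian_exponent_sum_less:
  fixes q :: real
  assumes q: "q \<ge> 2" and m: "1 \<le> m" "2 * m < d"
  shows "(\<Sum>k = 1..m. 1 / q ^ (k * (d - k))) < (1 / q) ^ (d - 1) * (1 + 1 / q)"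
proof -
  have geo: "(\<Sum>k = 2..m. (1 / q) ^ k) \<le> 1 / q - (1 / q) ^ m" if "1 \<le> m" for m
    using that
  proof (induction m rule: dec_induct)
    case (step m)
    have "2 * (1 / q) ^ Suc m \<le> (1 / q) ^ m"
      using q by (simp add: field_simps)
    then show ?case
      using step by simp
  qed simp
  have summand: "1 / q ^ (k * (d - k)) \<le> (1 / q) ^ (d - 1) * (1 / q) ^ k" if k_in: "k \<in> {2..m}" for k
  proof -
    define e where "e = d - 2 * k - 1"
    have d: "d = 2 * k + 1 + e" using k_in m by (simp add: e_def)
    obtain j where k: "k = Suc (Suc j)"
      using k_in le_Suc_ex[of 2 k] by (auto simp: numeral_2_eq_2)
    \<comment> \<open>With subtraction eliminated, both sides are polynomials in \<open>j\<close> and \<open>e\<close>.\<close>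
    have "d - 1 + k \<le> k * (d - k)"
      unfolding d k by (simp add: algebra_simps)
    then have "(1 / q) ^ (k * (d - k)) \<le> (1 / q) ^ (d - 1 + k)"
      using q by (intro power_decreasing) auto
    then show ?thesis
      by (simp add: power_add power_one_over)
  qed
  have "(\<Sum>k = 1..m. 1 / q ^ (k * (d - k))) = (1 / q) ^ (d - 1) + (\<Sum>k = 2..m. 1 / q ^ (k * (d - k)))"
    using m by (simp add: sum.atLeast_Suc_atMost power_one_over numeral_2_eq_2)
  also have "\<dots> \<le> (1 / q) ^ (d - 1) + (\<Sum>k = 2..m. (1 / q) ^ (d - 1) * (1 / q) ^ k)"
    using summand by (intro add_left_mono sum_mono)
  also have "\<dots> = (1 / q) ^ (d - 1) * (1 + (\<Sum>k = 2..m. (1 / q) ^ k))"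
    by (simp add: sum_distrib_left distrib_left)
  also have "\<dots> < (1 / q) ^ (d - 1) * (1 + 1 / q)"
  proof (rule mult_strict_left_mono)
    have "(1 / q) ^ m > 0" using q by simp
    then show "1 + (\<Sum>k = 2..m. (1 / q) ^ k) < 1 + 1 / q"
      using geo[OF m(1)] by linarith
  qed (use q in simp)
  finally show ?thesis .
qed

section \<open>The heart of a fat element\<close>

lemma subgroup_subset_invertible:
  "subgroup G (GL :: ('a::field ^ 'n ^ 'n) monoid) \<Longrightarrow> A \<in> G \<Longrightarrow> invertible A"
  using subgroup.mem_carrier[of G GL A] by (simp add: GL_def)

lemma submodule_singleton_iff:
  assumes "invertible (g :: 'a::field ^ 'n ^ 'n)"
  shows "submodule {g} U \<longleftrightarrow> vec.subspace U \<and> (\<lambda>v. v v* g) ` U = U"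
proof
  assume U: "submodule {g} U"
  then have "(\<lambda>v. v v* g) ` U = U"
    using assms by (intro vec.subspace_dim_equal subspace_image_mult_right)
      (auto simp: submodule_def dim_image_mult_right)
  with U show "vec.subspace U \<and> (\<lambda>v. v v* g) ` U = U"
    by (simp add: submodule_def)
qed (auto simp: submodule_def)

text \<open>
  An invariant subspace of an invertible matrix is mapped onto itself by dimension, hence is invariant
  under the inverse; so invariance under the generators suffices.
\<close>

lemma submodule_generate:
  assumes H: "H \<subseteq> carrier (GL :: ('a::field ^ 'n ^ 'n) monoid)"
  shows "submodule (generate GL H) U \<longleftrightarrow> submodule H U"
proof
  assume "submodule (generate GL H) U"
  then show "submodule H U"
    by (auto simp: submodule_def intro: generate.incl)
next
  assume U: "submodule H U"
  have "u v* g \<in> U" if "g \<in> generate GL H" "u \<in> U" for g u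
    using that
  proof (induction arbitrary: u)
    case one
    then show ?case by (simp add: GL_def)
  next
    case (incl h)
    then show ?case using U by (auto simp: submodule_def)
  next
    case (inv h)
    have h: "h \<in> carrier GL" using H inv by auto
    have "h ** inv\<^bsub>GL\<^esub> h = mat 1"
      using group.r_inv[OF group_GL h] by (simp add: GL_def)
    moreover have "submodule {h} U"
      using U inv by (auto simp: submodule_def)
    then have "(\<lambda>v. v v* h) ` U = U"
      using h by (simp add: submodule_singleton_iff GL_def)
    then obtain u' where "u' \<in> U" "u = u' v* h"
      using inv by auto
    ultimately show ?case
      by (simp add: vector_matrix_mul_assoc)
  next
    case (eng h1 h2)
    then have "(u v* h1) v* h2 \<in> U" by blast
    then show ?case
      by (simp add: GL_def vector_matrix_mul_assoc)
  qed
  then show "submodule (generate GL H) U"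
    using U by (auto simp: submodule_def)
qed

lemma irreducible_submodule_generate:
  "H \<subseteq> carrier (GL :: ('a::field ^ 'n ^ 'n) monoid) \<Longrightarrow>
    irreducible_submodule (generate GL H) U \<longleftrightarrow> irreducible_submodule H U"
  by (simp add: irreducible_submodule_def submodule_generate)

text \<open>
  The submodule that makes \<open>g\<close> fat. It is unique, see \<open>heart_unique\<close>, but a relation needs no default
  value for elements that are not fat.
\<close>

definition heart :: "'a::field ^ 'n ^ 'n \<Rightarrow> ('a ^ 'n) set \<Rightarrow> bool" where
  "heart g W \<longleftrightarrow> irreducible_submodule {g} W \<and> CARD('n) < 2 * vec.dim W"

lemma fat_iff_heart:
  assumes "invertible (g :: 'a::field ^ 'n ^ 'n)"
  shows "fat g \<longleftrightarrow> (\<exists>W. heart g W)"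
proof -
  have *: "real (vec.dim W) > real CARD('n) / 2 \<longleftrightarrow> CARD('n) < 2 * vec.dim W" for W :: "('a ^ 'n) set"
    by linarith
  show ?thesis
    unfolding fat_def heart_def *
    using assms by (subst irreducible_submodule_generate) (auto simp: GL_def)
qed

lemma heart_subspace: "heart g W \<Longrightarrow> vec.subspace W"
  by (simp add: heart_def irreducible_submodule_def submodule_def)

lemma heart_Int_cases:
  assumes "heart g W" "submodule {g} U"
  shows "W \<inter> U = {0} \<or> W \<inter> U = W"
proof -
  have "submodule {g} (W \<inter> U)"
    using assms
    by (auto simp: heart_def irreducible_submodule_def submodule_def vec.subspace_inter)
  then show ?thesis
    using assms(1) unfolding heart_def irreducible_submodule_def by (metis inf_le1)
qed

lemma dim_add_le_if_Int_trivial: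
  fixes W U :: "('a::field ^ 'n) set"
  assumes "vec.subspace W" "vec.subspace U" "W \<inter> U = {0}"
  shows "vec.dim W + vec.dim U \<le> CARD('n)"
proof -
  have "vec.dim {x + y | x y. x \<in> W \<and> y \<in> U} + vec.dim (W \<inter> U) = vec.dim W + vec.dim U"
    by (rule vec.dim_sums_Int[OF assms(1,2)])
  moreover have "vec.dim {x + y | x y. x \<in> W \<and> y \<in> U} \<le> CARD('n)"
    by (rule dim_subset_UNIV_cart_gen)
  ultimately show ?thesis using assms(3) by simp
qed

lemma heart_unique:
  fixes g :: "'a::field ^ 'n ^ 'n"
  assumes "heart g W" "heart g W'"
  shows "W = W'"
proof -
  have "W \<inter> W' \<noteq> {0}"
    using dim_add_le_if_Int_trivial[OF assms[THEN heart_subspace]] assms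
    by (auto simp: heart_def)
  moreover have "submodule {g} W" "submodule {g} W'"
    using assms by (auto simp: heart_def irreducible_submodule_def)
  ultimately show ?thesis
    using heart_Int_cases[OF assms(1), of W'] heart_Int_cases[OF assms(2), of W]
    by (metis inf_commute)
qed

text \<open>
  The heart depends only on the action on it. This is what allows the orbit-counting argument to change
  an element outside its heart.
\<close>

lemma heart_cong:
  assumes "heart g W" "\<And>w. w \<in> W \<Longrightarrow> w v* h = w v* g"
  shows "heart h W"
proof -
  have "submodule {h} U \<longleftrightarrow> submodule {g} U" if "U \<subseteq> W" for U
  proof -
    have "\<forall>w\<in>U. w v* h = w v* g" using that assms(2) by blast
    then show ?thesis by (simp add: submodule_def)
  qed
  then show ?thesis
    using assms(1) by (auto simp: heart_def irreducible_submodule_def)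
qed

lemma submodule_conjugate:
  fixes g t t' :: "'a::field ^ 'n ^ 'n"
  assumes "t' ** t = mat 1" "t ** t' = mat 1"
  shows "submodule {t' ** g ** t} ((\<lambda>v. v v* t) ` U) \<longleftrightarrow> submodule {g} U"
proof -
  have "submodule {t' ** g ** t} ((\<lambda>v. v v* t) ` U)" if "submodule {g} U"
      "t ** t' = mat 1" for U g and t t' :: "'a ^ 'n ^ 'n"
  proof -
    have "(u v* t) v* (t' ** g ** t) = (u v* g) v* t" for u
      by (simp add: vector_matrix_mul_assoc matrix_mul_assoc that(2))
    then show ?thesis
      using that(1) by (auto simp: submodule_def subspace_image_mult_right)
  qed
  note conj = this
  show ?thesis
  proof
    assume "submodule {t' ** g ** t} ((\<lambda>v. v v* t) ` U)"
    from conj[OF this assms(1)]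
    have "submodule {(t ** t') ** g ** (t ** t')} ((\<lambda>v. v v* (t ** t')) ` U)"
      by (simp add: matrix_mul_assoc image_image vector_matrix_mul_assoc)
    then show "submodule {g} U" by (simp add: assms)
  next
    assume "submodule {g} U"
    then show "submodule {t' ** g ** t} ((\<lambda>v. v v* t) ` U)"
      by (rule conj) (rule assms(2))
  qed
qed

lemma heart_conjugate:
  fixes g t t' :: "'a::field ^ 'n ^ 'n"
  assumes "heart g W" "t' ** t = mat 1" "t ** t' = mat 1"
  shows "heart (t' ** g ** t) ((\<lambda>v. v v* t) ` W)"
proof -
  let ?T = "\<lambda>v :: 'a ^ 'n. v v* t"
  have inv: "invertible t" using assms by (auto simp: invertible_def)
  have W: "submodule {g} W" "W \<noteq> {0}" "\<And>U. submodule {g} U \<Longrightarrow> U \<subseteq> W \<Longrightarrow> U = {0} \<or> U = W"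
    using assms(1) by (auto simp: heart_def irreducible_submodule_def)
  have "U = {0} \<or> U = ?T ` W" if U: "submodule {t' ** g ** t} U" "U \<subseteq> ?T ` W" for U
  proof -
    obtain U0 where U0: "U = ?T ` U0" "U0 \<subseteq> W"
      using U(2) by (meson subset_imageE)
    then have "submodule {g} U0"
      using U(1) submodule_conjugate[OF assms(2,3)] by simp
    from W(3)[OF this U0(2)] show ?thesis by (auto simp: U0(1))
  qed
  moreover have "?T ` W \<noteq> {0}"
  proof
    assume "?T ` W = {0}"
    then have "?T ` W = ?T ` {0}" by simp
    then show False
      using W(2) by (simp only: inj_image_eq_iff[OF inj_mult_right[OF inv]])
  qed
  ultimately show ?thesis
    using assms W by (simp add: heart_def irreducible_submodule_def submodule_conjugate
        dim_image_mult_right[OF inv])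
qed

section \<open>Subspaces shared by two fat elements\<close>

text \<open>
  The two possible positions of an invariant subspace \<open>U\<close> relative to a heart \<open>W\<close>: containing it if \<open>c\<close>
  is true, and meeting it trivially otherwise. In either case \<open>W \<inter> U\<close> is determined by \<open>W\<close>, which is the
  hypothesis of \<open>SL_transitive_fixing\<close>; so both cases can be treated at once.
\<close>

definition meets :: "bool \<Rightarrow> 'b set \<Rightarrow> ('b::zero) set \<Rightarrow> bool" where
  "meets c W U \<longleftrightarrow> W \<inter> U = (if c then W else {0})"

definition incidences ::
  "('a::field ^ 'n ^ 'n) set \<Rightarrow> bool \<Rightarrow> nat \<Rightarrow> (('a ^ 'n ^ 'n) \<times> ('a ^ 'n) set) set" where
  "incidences G c k = {(g, U). g \<in> G \<and> U \<in> Grassmannian k \<and> submodule {g} U \<and>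
     (\<exists>W. heart g W \<and> meets c W U)}"

text \<open>
  For each heart \<open>W\<close> choose one admissible subspace, the base of \<open>W\<close>, and for each admissible \<open>U\<close> a matrix
  \<open>s\<close> of determinant 1 that fixes \<open>W\<close> pointwise and maps the base to \<open>U\<close>. The incidence \<open>(g, U)\<close> is sent to
  the element \<open>s ** g\<close>. This element acts on \<open>W\<close> as \<open>g\<close> does, so it is fat with heart \<open>W\<close>, and it maps the
  base of \<open>W\<close> to \<open>U\<close>, since \<open>g\<close> preserves \<open>U\<close>. Hence \<open>W\<close>, then \<open>U\<close>, then \<open>s\<close>, and finally \<open>g\<close> can be
  recovered from it.
\<close>

lemma card_incidences_le:
  fixes G :: "('a::{field,finite} ^ 'n ^ 'n) set"
  assumes G: "subgroup G GL" "SL \<subseteq> G" and k: "0 < k" "k < CARD('n)"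
  shows "card (incidences G c k) \<le> card {g \<in> G. fat g}"
proof -
  define H where "H g = (THE W. heart g W)" for g :: "'a ^ 'n ^ 'n"
  have H: "H g = W" if "heart g W" for g W
    unfolding H_def
  proof (rule the_equality)
    show "heart g W" by (rule that)
    show "W' = W" if "heart g W'" for W'
      using that \<open>heart g W\<close> by (rule heart_unique)
  qed
  define \<Omega> where "\<Omega> W = {U \<in> Grassmannian k. meets c W U}" for W :: "('a ^ 'n) set"
  define base where "base W = (SOME U. U \<in> \<Omega> W)" for W
  define s where "s W U = (SOME A. A \<in> SL \<and> (\<forall>w\<in>W. w v* A = w) \<and> (\<lambda>v. v v* A) ` base W = U)"
    for W and U :: "('a ^ 'n) set"
  have s: "s W U \<in> SL \<and> (\<forall>w\<in>W. w v* s W U = w) \<and> (\<lambda>v. v v* s W U) ` base W = U"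
    if W: "vec.subspace W" and U: "U \<in> \<Omega> W" for W U
  proof -
    have b: "base W \<in> \<Omega> W"
      unfolding base_def using U by (rule someI)
    \<comment> \<open>A heart that is the whole space is incident only with \<open>UNIV\<close> or \<open>{0}\<close>, which \<open>k\<close> excludes.\<close>
    have "W \<noteq> UNIV"
    proof
      assume "W = UNIV"
      then have "U = UNIV \<or> U = {0}"
        using U by (auto simp: \<Omega>_def meets_def split: if_splits)
      then have "vec.dim U = CARD('n) \<or> vec.dim U = 0"
        by (auto simp: card_cart_basis)
      moreover have "vec.dim U = k"
        using U by (simp add: \<Omega>_def Grassmannian_def)
      ultimately show False
        using k by linarith
    qed
    moreover have "vec.subspace U" "vec.subspace (base W)" "vec.dim (base W) = vec.dim U"
      "W \<inter> base W = W \<inter> U"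
      using U b by (auto simp: \<Omega>_def Grassmannian_def meets_def)
    ultimately obtain A where "A \<in> SL" "\<And>w. w \<in> W \<Longrightarrow> w v* A = w" "(\<lambda>v. v v* A) ` base W = U"
      using SL_transitive_fixing[OF W, of "base W" U] by auto
    then have "\<exists>A. A \<in> SL \<and> (\<forall>w\<in>W. w v* A = w) \<and> (\<lambda>v. v v* A) ` base W = U"
      by blast
    then show ?thesis
      unfolding s_def by (rule someI_ex)
  qed
  define \<phi> where "\<phi> = (\<lambda>(g, U). s (H g) U ** g)"
  have inc: "\<exists>W. heart g W \<and> H g = W \<and> vec.subspace W \<and> U \<in> \<Omega> W \<and> g \<in> G \<and>
      invertible g \<and> (\<lambda>v. v v* g) ` U = U"
    if "(g, U) \<in> incidences G c k" for g U
  proof -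
    from that obtain W where W: "g \<in> G" "U \<in> Grassmannian k" "submodule {g} U" "heart g W"
      "meets c W U"
      by (auto simp: incidences_def)
    moreover have "invertible g"
      using subgroup_subset_invertible[OF G(1)] W(1) by blast
    ultimately show ?thesis
      using H heart_subspace by (intro exI[of _ W]) (auto simp: \<Omega>_def submodule_singleton_iff)
  qed
  have heart_\<phi>: "heart (\<phi> (g, U)) (H g)" and base_\<phi>: "(\<lambda>v. v v* \<phi> (g, U)) ` base (H g) = U"
    if gU: "(g, U) \<in> incidences G c k" for g U
  proof -
    from inc[OF gU] obtain W where W: "heart g W" "H g = W" "vec.subspace W" "U \<in> \<Omega> W"
      "(\<lambda>v. v v* g) ` U = U" by blast
    show "heart (\<phi> (g, U)) (H g)"
      unfolding W(2) using W s[OF W(3,4)]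
      by (intro heart_cong[OF W(1)]) (simp add: \<phi>_def flip: vector_matrix_mul_assoc)
    show "(\<lambda>v. v v* \<phi> (g, U)) ` base (H g) = U"
      using W s[OF W(3,4)] by (simp add: \<phi>_def image_mult_right_mult)
  qed
  have "inj_on \<phi> (incidences G c k)"
  proof (rule inj_onI, clarify)
    fix g U g' U'
    assume gU: "(g, U) \<in> incidences G c k" and gU': "(g', U') \<in> incidences G c k"
      and eq: "\<phi> (g, U) = \<phi> (g', U')"
    have HH: "H g = H g'"
      using heart_\<phi>[OF gU] heart_\<phi>[OF gU'] eq heart_unique by metis
    then have UU: "U = U'"
      using base_\<phi>[OF gU] base_\<phi>[OF gU'] eq by metis
    have "s (H g) U \<in> SL"
      using inc[OF gU] s by blast
    then obtain B where "B ** s (H g) U = mat 1"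
      using invertible_det_nz[of "s (H g) U"] by (auto simp: SL_def invertible_def)
    moreover have "B ** (s (H g) U ** g) = B ** (s (H g) U ** g')"
      using eq HH UU by (simp add: \<phi>_def)
    ultimately have "g = g'"
      by (simp add: matrix_mul_assoc)
    with UU show "g = g' \<and> U = U'" by simp
  qed
  moreover have "\<phi> ` incidences G c k \<subseteq> {g \<in> G. fat g}"
  proof clarify
    fix g U assume gU: "(g, U) \<in> incidences G c k"
    have "s (H g) U \<in> G" "g \<in> G"
      using inc[OF gU] s G(2) by blast+
    then have "\<phi> (g, U) \<in> G"
      using subgroup.m_closed[OF G(1)] by (simp add: \<phi>_def GL_def)
    then show "\<phi> (g, U) \<in> G \<and> fat (\<phi> (g, U))"
      using heart_\<phi>[OF gU] subgroup_subset_invertible[OF G(1)] by (auto simp: fat_iff_heart)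
  qed
  ultimately show ?thesis
    by (intro card_inj_on_le[of \<phi>]) auto
qed

text \<open>
  Conjugation by a matrix of determinant 1 that maps \<open>U\<close> to \<open>U'\<close>. By symmetry the two sides are equal.
\<close>

lemma card_incidence_fibre_le:
  fixes G :: "('a::{field,finite} ^ 'n ^ 'n) set"
  assumes G: "subgroup G GL" "SL \<subseteq> G"
    and U: "U \<in> Grassmannian k" and U': "U' \<in> Grassmannian k"
  shows "card {g. (g, U) \<in> incidences G c k} \<le> card {g. (g, U') \<in> incidences G c k}"
proof -
  have "\<exists>t\<in>SL. (\<lambda>v. v v* t) ` U = U'"
  proof -
    have "(axis undefined 1 :: 'a ^ 'n) \<noteq> 0" by (simp add: axis_eq_0_iff)
    then have "{0 :: 'a ^ 'n} \<noteq> UNIV" by blast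
    then show ?thesis
      using SL_transitive_fixing[of "{0}" U U'] U U'
      by (auto simp: Grassmannian_def vec.subspace_0)
  qed
  then obtain t where t: "t \<in> SL" "(\<lambda>v. v v* t) ` U = U'" ..
  then have "invertible t"
    by (simp add: SL_def invertible_det_nz)
  then obtain t' where t': "t' ** t = mat 1" "t ** t' = mat 1"
    by (auto simp: invertible_def)
  have "det t' * det t = 1"
    using t'(1) by (metis det_I det_mul)
  then have t'SL: "t' \<in> SL"
    using t by (simp add: SL_def)
  let ?f = "\<lambda>g. t' ** g ** t"
  have "inj_on ?f {g. (g, U) \<in> incidences G c k}"
  proof (rule inj_onI)
    fix g h assume "?f g = ?f h"
    then have "t ** ?f g ** t' = t ** ?f h ** t'" by simp
    then have "(t ** t') ** g ** (t ** t') = (t ** t') ** h ** (t ** t')"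
      by (simp add: matrix_mul_assoc)
    then show "g = h" by (simp add: t')
  qed
  moreover have "?f ` {g. (g, U) \<in> incidences G c k} \<subseteq> {g. (g, U') \<in> incidences G c k}"
  proof clarify
    fix g assume "(g, U) \<in> incidences G c k"
    then obtain W where g: "g \<in> G" "submodule {g} U" "heart g W" "meets c W U"
      by (auto simp: incidences_def)
    have "A ** B \<in> G" if "A \<in> G" "B \<in> G" for A B
      using subgroup.m_closed[OF G(1) that] by (simp add: GL_def)
    then have "?f g \<in> G"
      using g(1) G(2) t(1) t'SL by blast
    moreover have "submodule {?f g} U'"
      using submodule_conjugate[OF t', of g U] g(2) t(2) by simp
    moreover have "heart (?f g) ((\<lambda>v. v v* t) ` W)"
      by (rule heart_conjugate[OF g(3) t'])
    moreover have "meets c ((\<lambda>v. v v* t) ` W) U'"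
      using g(4) image_Int[OF inj_mult_right[OF \<open>invertible t\<close>], of W U] t(2)
      by (auto simp: meets_def split: if_splits)
    ultimately show "(?f g, U') \<in> incidences G c k"
      using U' by (auto simp: incidences_def)
  qed
  ultimately show ?thesis
    by (intro card_inj_on_le[of ?f]) auto
qed

definition sharing_pairs ::
  "('a::field ^ 'n ^ 'n) set \<Rightarrow> bool \<Rightarrow> nat \<Rightarrow> (('a ^ 'n ^ 'n) \<times> ('a ^ 'n ^ 'n)) set" where
  "sharing_pairs G c k =
     {(g1, g2). \<exists>U. (g1, U) \<in> incidences G c k \<and> (g2, U) \<in> incidences G c k}"

text \<open>
  With \<open>S\<close> subspaces of dimension \<open>k\<close>, each incident with \<open>a\<close> elements, there are \<open>S a\<close> incidences, and at
  most \<open>S a\<^sup>2\<close> pairs share one. So \<open>S\<close> times the number of these pairs is at most the square of the number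
  of incidences.
\<close>

lemma card_sharing_pairs_le:
  fixes G :: "('a::{field,finite} ^ 'n ^ 'n) set"
  assumes G: "subgroup G GL" "SL \<subseteq> G" and k: "0 < k" "k < CARD('n)"
  shows "card (Grassmannian k :: ('a ^ 'n) set set) * card (sharing_pairs G c k)
    \<le> (card {g \<in> G. fat g})\<^sup>2"
proof -
  let ?Gr = "Grassmannian k :: ('a ^ 'n) set set"
  define fib where "fib U = {g. (g, U) \<in> incidences G c k}" for U
  have "\<exists>a. \<forall>U\<in>?Gr. card (fib U) = a"
    unfolding fib_def by (metis card_incidence_fibre_le[OF G] antisym)
  then obtain a where a: "\<And>U. U \<in> ?Gr \<Longrightarrow> card (fib U) = a" by blast
  have "incidences G c k = (\<lambda>(U, g). (g, U)) ` (SIGMA U:?Gr. fib U)"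
    by (auto simp: fib_def incidences_def image_iff)
  then have "card (incidences G c k) = card (SIGMA U:?Gr. fib U)"
    by (simp add: card_image inj_on_def split_beta prod_eq_iff)
  also have "\<dots> = card ?Gr * a"
    using a by (simp add: card_SigmaI)
  finally have I: "card ?Gr * a \<le> card {g \<in> G. fat g}"
    using card_incidences_le[OF G k, of c] by simp
  have "sharing_pairs G c k = (\<Union>U\<in>?Gr. fib U \<times> fib U)"
    by (auto simp: sharing_pairs_def fib_def incidences_def)
  then have "card (sharing_pairs G c k) \<le> (\<Sum>U\<in>?Gr. card (fib U \<times> fib U))"
    by (simp only: card_UN_le finite)
  also have "\<dots> = card ?Gr * a\<^sup>2"
    using a by (simp add: card_cartesian_product power2_eq_square)
  finally have "card ?Gr * card (sharing_pairs G c k) \<le> card ?Gr * (card ?Gr * a\<^sup>2)"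
    by simp
  also have "\<dots> = (card ?Gr * a)\<^sup>2"
    by (simp add: power2_eq_square)
  also have "\<dots> \<le> (card {g \<in> G. fat g})\<^sup>2"
    using I by (rule power_mono) simp
  finally show ?thesis .
qed

lemma real_card_sharing_pairs_le:
  fixes G :: "('a::{field,finite} ^ 'n ^ 'n) set"
  assumes G: "subgroup G GL" "SL \<subseteq> G" and k: "0 < k" "k < CARD('n)"
  shows "real (card (sharing_pairs G c k)) \<le> (real (card {g \<in> G. fat g}))\<^sup>2 /
      (1 + 1 / real CARD('a)) * (1 / real CARD('a) ^ (k * (CARD('n) - k)))"
proof -
  define B where "B = real CARD('a) ^ (k * (CARD('n) - k)) * (1 + 1 / real CARD('a))"
  let ?Gr = "card (Grassmannian k :: ('a ^ 'n) set set)"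
  have "B * real (card (sharing_pairs G c k)) \<le> real ?Gr * real (card (sharing_pairs G c k))"
    unfolding B_def by (intro mult_right_mono card_Grassmannian_ge k) simp
  also have "\<dots> \<le> (real (card {g \<in> G. fat g}))\<^sup>2"
    using card_sharing_pairs_le[OF G k, of c] by (metis of_nat_le_iff of_nat_mult of_nat_power)
  finally have "B * real (card (sharing_pairs G c k)) \<le> (real (card {g \<in> G. fat g}))\<^sup>2" .
  moreover have "B > 0"
    unfolding B_def using two_le_card_field[where 'a = 'a]
    by (intro mult_pos_pos zero_less_power add_pos_nonneg) auto
  ultimately have "real (card (sharing_pairs G c k)) \<le> (real (card {g \<in> G. fat g}))\<^sup>2 / B"
    by (simp add: pos_le_divide_eq mult.commute)
  then show ?thesis
    by (simp add: B_def mult.commute)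
qed

text \<open>
  A common invariant subspace of dimension more than \<open>d/2\<close> must contain both hearts, and one of
  dimension less than \<open>d/2\<close> must meet both trivially; dimension \<open>d/2\<close> cannot occur. The number \<open>k\<close> is the
  codimension in the first case and the dimension in the second.
\<close>

lemma reducible_fat_pair_cases:
  fixes g1 g2 :: "'a::field ^ 'n ^ 'n"
  assumes G: "subgroup G GL" "g1 \<in> G" "g2 \<in> G" and fat: "fat g1" "fat g2"
    and red: "reducible_pair (g1, g2)"
  obtains k where "1 \<le> k" "2 * k < CARD('n)"
    "(g1, g2) \<in> sharing_pairs G True (CARD('n) - k) \<union> sharing_pairs G False k"
proof -
  have inv: "invertible g1" "invertible g2"
    using G subgroup_subset_invertible by blast+
  obtain W1 W2 where W: "heart g1 W1" "heart g2 W2"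
    using fat inv fat_iff_heart by blast
  have "\<not> irreducible_submodule {g1, g2} UNIV"
    using red irreducible_submodule_generate[of "{g1, g2}"] inv
    by (simp add: reducible_pair_def irreducible_pair_def) (simp add: GL_def)
  moreover have "submodule {g1, g2} UNIV"
    by (simp add: submodule_def)
  moreover have "(UNIV :: ('a ^ 'n) set) \<noteq> {0}"
  proof -
    have "(axis undefined 1 :: 'a ^ 'n) \<noteq> 0" by (simp add: axis_eq_0_iff)
    then show ?thesis by blast
  qed
  ultimately obtain U where U: "submodule {g1, g2} U" "U \<noteq> {0}" "U \<noteq> UNIV"
    by (auto simp: irreducible_submodule_def)
  then have sU: "vec.subspace U" and U12: "submodule {g1} U" "submodule {g2} U"
    by (auto simp: submodule_def)
  have "vec.dim U \<noteq> 0"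
    using U(2) sU vec.subspace_0 by auto
  moreover have "vec.dim U < CARD('n)"
    using U(3) vec.subspace_dim_equal[OF sU vec.subspace_UNIV subset_UNIV]
    by (cases "vec.dim U < CARD('n)") (auto simp: card_cart_basis)
  ultimately have dU: "0 < vec.dim U" "vec.dim U < CARD('n)" by auto
  have big: "CARD('n) < 2 * vec.dim U" if "heart g W" "W \<inter> U = W" for g W
  proof -
    have "vec.dim W \<le> vec.dim U"
      using that(2) by (intro vec.dim_subset) blast
    then show ?thesis using that(1) by (simp add: heart_def)
  qed
  have small: "2 * vec.dim U < CARD('n)" if "heart g W" "W \<inter> U = {0}" for g W
  proof -
    have "vec.dim W + vec.dim U \<le> CARD('n)"
      by (rule dim_add_le_if_Int_trivial[OF heart_subspace[OF that(1)] sU that(2)])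
    then show ?thesis using that(1) by (simp add: heart_def)
  qed
  have "(W1 \<inter> U = W1 \<and> W2 \<inter> U = W2 \<and> CARD('n) < 2 * vec.dim U) \<or>
      (W1 \<inter> U = {0} \<and> W2 \<inter> U = {0} \<and> 2 * vec.dim U < CARD('n))"
    using heart_Int_cases[OF W(1) U12(1)] heart_Int_cases[OF W(2) U12(2)]
      big[OF W(1)] big[OF W(2)] small[OF W(1)] small[OF W(2)] by linarith
  then show thesis
  proof (elim disjE conjE)
    assume "W1 \<inter> U = W1" "W2 \<inter> U = W2" "CARD('n) < 2 * vec.dim U"
    then show thesis
      using dU W U12 sU G
      by (intro that[of "CARD('n) - vec.dim U"] UnI1)
        (auto simp: sharing_pairs_def incidences_def Grassmannian_def meets_def)
  next
    assume "W1 \<inter> U = {0}" "W2 \<inter> U = {0}" "2 * vec.dim U < CARD('n)"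
    then show thesis
      using dU W U12 sU G
      by (intro that[of "vec.dim U"] UnI2)
        (auto simp: sharing_pairs_def incidences_def Grassmannian_def meets_def)
  qed
qed


section \<open>The proportion of reducible fat pairs\<close>

lemma card_reducible_fat_pairs_le:
  fixes G :: "('a::{field,finite} ^ 'n ^ 'n) set"
  assumes "subgroup G GL"
  shows "card {p \<in> fat_pairs G. reducible_pair p}
    \<le> (\<Sum>k = 1..(CARD('n) - 1) div 2.
          card (sharing_pairs G True (CARD('n) - k)) + card (sharing_pairs G False k))"
proof -
  define m where "m = (CARD('n) - 1) div 2"
  define S where "S k = sharing_pairs G True (CARD('n) - k) \<union> sharing_pairs G False k" for k
  have "{p \<in> fat_pairs G. reducible_pair p} \<subseteq> (\<Union>k\<in>{1..m}. S k)"
  proof clarify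
    fix g1 g2 assume p: "(g1, g2) \<in> fat_pairs G" "reducible_pair (g1, g2)"
    then have g: "g1 \<in> G" "g2 \<in> G" "fat g1" "fat g2" by (auto simp: fat_pairs_def)
    obtain k where k: "1 \<le> k" "2 * k < CARD('n)" and S: "(g1, g2) \<in> S k"
      unfolding S_def by (rule reducible_fat_pair_cases[OF assms g p(2)])
    have "k \<le> m"
      unfolding m_def using k(2) by linarith
    then show "(g1, g2) \<in> (\<Union>k\<in>{1..m}. S k)"
      using k(1) S by (intro UN_I[of k]) simp_all
  qed
  then have "card {p \<in> fat_pairs G. reducible_pair p} \<le> card (\<Union>k\<in>{1..m}. S k)"
    by (intro card_mono) auto
  also have "\<dots> \<le> (\<Sum>k = 1..m. card (S k))"
    by (rule card_UN_le) simp
  also have "\<dots> \<le> (\<Sum>k = 1..m. card (sharing_pairs G True (CARD('n) - k)) + card (sharing_pairs G False k))"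
    unfolding S_def by (intro sum_mono card_Un_le)
  finally show ?thesis
    by (simp add: m_def)
qed

theorem theorem1p2:
  fixes G :: "('a::{field,finite} ^ 'n::finite ^ 'n) set"
    and d q :: nat
  assumes "d = CARD('n)"
    and "q = CARD('a)"
    and "d \<ge> 3"
    and "subgroup G GL"
    and "SL \<subseteq> G"
  shows "kappa G < 2 * real q powi (- int d + 1)"
proof -
  define r where "r = real q"
  have r: "r \<ge> 2"
    using two_le_card_field[where 'a = 'a] by (simp add: r_def assms(2))
  have r1: "1 + 1 / r > 0"
    using r by (simp add: add_pos_pos)
  have bound: "2 * real q powi (- int d + 1) = 2 * (1 / r) ^ (d - 1)"
  proof -
    have "- int d + 1 = - int (d - 1)" using assms(3) by simp
    then have "real q powi (- int d + 1) = inverse (r ^ (d - 1))"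
      by (simp only: r_def power_int_minus power_int_of_nat)
    then show ?thesis
      by (simp only: power_one_over inverse_eq_divide)
  qed
  define F where "F = card {g \<in> G. fat g}"
  have "fat_pairs G = {g \<in> G. fat g} \<times> {g \<in> G. fat g}"
    by (auto simp: fat_pairs_def)
  then have card_fat_pairs: "card (fat_pairs G) = F\<^sup>2"
    by (simp add: F_def card_cartesian_product power2_eq_square)
  define m where "m = (d - 1) div 2"
  have m: "1 \<le> m" "2 * m < d"
    using assms(3) by (auto simp: m_def)
  define T where "T = (\<Sum>k = 1..m. 1 / r ^ (k * (d - k)))"
  have T: "T < (1 / r) ^ (d - 1) * (1 + 1 / r)"
    unfolding T_def by (rule Gaussian_exponent_sum_less[OF r m])
  have S: "real (card (sharing_pairs G c j)) \<le> (real F)\<^sup>2 / (1 + 1 / r) * (1 / r ^ (k * (d - k)))"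
    if "0 < j" "j < d" "j * (d - j) = k * (d - k)" for c j k
    using real_card_sharing_pairs_le[OF assms(4,5), of j c] that
    unfolding r_def F_def assms(1,2) by metis
  have "real (card {p \<in> fat_pairs G. reducible_pair p})
      \<le> (\<Sum>k = 1..m. real (card (sharing_pairs G True (d - k))) + real (card (sharing_pairs G False k)))"
    using card_reducible_fat_pairs_le[OF assms(4)]
    unfolding of_nat_add[symmetric] of_nat_sum[symmetric] of_nat_le_iff m_def assms(1) .
  also have "\<dots> \<le> (\<Sum>k = 1..m. 2 * (real F)\<^sup>2 / (1 + 1 / r) * (1 / r ^ (k * (d - k))))"
  proof (rule sum_mono)
    fix k assume "k \<in> {1..m}"
    then have k: "0 < k" "k < d" "0 < d - k" "d - k < d" "(d - k) * (d - (d - k)) = k * (d - k)"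
      using m by auto
    show "real (card (sharing_pairs G True (d - k))) + real (card (sharing_pairs G False k))
        \<le> 2 * (real F)\<^sup>2 / (1 + 1 / r) * (1 / r ^ (k * (d - k)))"
      using S[OF k(3-5), of True] S[OF k(1,2) refl, of False] by simp
  qed
  also have "\<dots> = 2 * (real F)\<^sup>2 / (1 + 1 / r) * T"
    unfolding T_def by (rule sum_distrib_left[symmetric])
  finally have num: "real (card {p \<in> fat_pairs G. reducible_pair p})
      \<le> 2 * (real F)\<^sup>2 / (1 + 1 / r) * T" .
  show ?thesis
  proof (cases "F = 0")
    case True
    \<comment> \<open>The quotient is then \<open>0 / 0 = 0\<close>; this saves a proof that fat elements exist.\<close>
    then have "kappa G = 0" by (simp add: kappa_def card_fat_pairs)
    then show ?thesis unfolding bound using r by simp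
  next
    case False
    have "kappa G \<le> 2 * (real F)\<^sup>2 / (1 + 1 / r) * T / (real F)\<^sup>2"
      unfolding kappa_def card_fat_pairs of_nat_power
      using num by (rule divide_right_mono) simp
    also have "\<dots> = 2 / (1 + 1 / r) * T"
      using False by simp
    also have "\<dots> < 2 / (1 + 1 / r) * ((1 / r) ^ (d - 1) * (1 + 1 / r))"
      using T r1 by (intro mult_strict_left_mono) auto
    also have "\<dots> = 2 * (1 / r) ^ (d - 1)"
      using r1 by simp
    finally show ?thesis unfolding bound .
  qed
qed

end
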